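(* For every positive integer $k$ there exists a quasi-perfect $1$-error-correcting code in the Cartesian product $C_3 \square C_6 \square C_{4k}$, and for all positive integers $p,q,k$ there exists a quasi-perfect $1$-error-correcting code in $C_{3p} \square C_{6q} \square C_{4k}$.
   Context: All graphs are simple and connected; $d(x,y)$ is the shortest-path distance. For $n\ge 3$, $C_n$ is the cycle on $n$ vertices. The Cartesian product $G\square H$ has vertex set $V(G)\times V(H)$, with $(g_1,h_1)$ adjacent to $(g_2,h_2)$ iff either $h_1=h_2$ and $g_1g_2\in E(G)$, or $g_1=g_2$ and $h_1h_2\in E(H)$. A code is a subset $D$ of the vertex set. $D$ is $t$-error-correcting if any two distinct codewords are at distance at least $2t+1$. The covering radius of $D$ is the smallest $r$ such that every vertex is at distance at most $r$ from some codeword. A quasi-perfect $t$-error-correcting code is a $t$-error-correcting code with covering radius $t+1$. *)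

theory Defs
  imports "Graph_Theory.Graph_Theory"
begin

text \<open>A simple graph is a symmetric loop-free pair digraph, each edge being the two arcs
  between its ends. The vertices of \<open>C_n\<close> are the residues \<open>0, \<dots>, n - 1\<close>; for \<open>n < 3\<close> the
  definition does not give a cycle.\<close>

definition cycle_graph :: "nat \<Rightarrow> nat pair_pre_digraph" where
  "cycle_graph n =
    \<lparr> pverts = {..<n},
      parcs = {(i, j). i < n \<and> j < n \<and> (j = Suc i mod n \<or> i = Suc j mod n)} \<rparr>"

definition cartesian_product ::
    "'a pair_pre_digraph \<Rightarrow> 'b pair_pre_digraph \<Rightarrow> ('a \<times> 'b) pair_pre_digraph"
    (infixr \<open>\<box>\<close> 70) where
  "G \<box> H =
    \<lparr> pverts = pverts G \<times> pverts H,
      parcs = {((g1, h1), (g2, h2)).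
        (h1 = h2 \<and> h1 \<in> pverts H \<and> (g1, g2) \<in> parcs G) \<or>
        (g1 = g2 \<and> g1 \<in> pverts G \<and> (h1, h2) \<in> parcs H)} \<rparr>"

text \<open>Every arc has weight 1, so the library's shortest-path cost \<open>\<mu>\<close> is the number of edges
  of a shortest path (and \<open>\<infinity>\<close> if there is none).\<close>

definition graph_dist :: "'a pair_pre_digraph \<Rightarrow> 'a \<Rightarrow> 'a \<Rightarrow> ereal" where
  "graph_dist G u v = wf_digraph.\<mu> (with_proj G) (\<lambda>_. 1) u v"

definition error_correcting :: "'a pair_pre_digraph \<Rightarrow> nat \<Rightarrow> 'a set \<Rightarrow> bool" where
  "error_correcting G t D \<longleftrightarrow>
    D \<subseteq> pverts G \<and>
    (\<forall>x\<in>D. \<forall>y\<in>D. x \<noteq> y \<longrightarrow> ereal (real (2 * t + 1)) \<le> graph_dist G x y)"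

text \<open>The infimum is taken in \<^typ>\<open>enat\<close>, where it is the least element of a nonempty set and
  \<open>\<infinity>\<close> if no radius works (e.g. for the empty code).\<close>

definition covering_radius :: "'a pair_pre_digraph \<Rightarrow> 'a set \<Rightarrow> enat" where
  "covering_radius G D =
    Inf {enat r | r. \<forall>v\<in>pverts G. \<exists>c\<in>D. graph_dist G v c \<le> ereal (real r)}"

definition quasi_perfect :: "'a pair_pre_digraph \<Rightarrow> nat \<Rightarrow> 'a set \<Rightarrow> bool" where
  "quasi_perfect G t D \<longleftrightarrow> error_correcting G t D \<and> covering_radius G D = enat (t + 1)"

lemma pair_graph_cycle_graph:
  assumes "n \<ge> 3"
  shows "pair_graph (cycle_graph n)"
proof
  show "finite (parcs (cycle_graph n))"
    by (rule finite_subset[of _ "{..<n} \<times> {..<n}"]) (auto simp: cycle_graph_def)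
  show "fst e \<noteq> snd e" if "e \<in> parcs (cycle_graph n)" for e
    using that assms by (auto simp: cycle_graph_def mod_Suc split: if_splits)
qed (auto simp: cycle_graph_def symmetric_def sym_def arcs_ends_def arc_to_ends_def)

lemma pair_graph_cartesian_product:
  assumes "pair_graph G" "pair_graph H"
  shows "pair_graph (G \<box> H)"
proof -
  interpret G: pair_graph G by fact
  interpret H: pair_graph H by fact
  have sub: "parcs (G \<box> H) \<subseteq> (pverts G \<times> pverts H) \<times> (pverts G \<times> pverts H)"
    using G.in_arcsD1 G.in_arcsD2 H.in_arcsD1 H.in_arcsD2
    by (auto simp: cartesian_product_def)
  show ?thesis
  proof
    show "fst e \<in> pverts (G \<box> H)" "snd e \<in> pverts (G \<box> H)" if "e \<in> parcs (G \<box> H)" for e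
      using that G.in_arcsD1 G.in_arcsD2 H.in_arcsD1 H.in_arcsD2
      by (auto simp: cartesian_product_def)
    show "finite (parcs (G \<box> H))"
      by (rule finite_subset[OF sub]) simp
    show "fst e \<noteq> snd e" if "e \<in> parcs (G \<box> H)" for e
      using that G.pair_no_loops H.pair_no_loops by (auto simp: cartesian_product_def)
    show "symmetric (with_proj (G \<box> H))"
      using G.arcs_symmetric H.arcs_symmetric
      by (auto simp: cartesian_product_def symmetric_def sym_def arcs_ends_def arc_to_ends_def)
  qed (auto simp: cartesian_product_def)
qed

end

theory Submission
  imports Defs
begin

text \<open>Give the vertex \<open>(x, y, z)\<close> the syndrome \<open>4x + 2y + 3z\<close> in \<open>\<int>/12\<close>, which is well defined on the
  product because \<open>12\<close> divides \<open>4 \<cdot> 3p\<close>, \<open>2 \<cdot> 6q\<close> and \<open>3 \<cdot> 4k\<close>. The code consists of the vertices of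
  syndrome \<open>0\<close>. The six neighbours of a vertex change the syndrome by \<open>\<plusminus>2, \<plusminus>3, \<plusminus>4\<close>; these are nonzero
  and pairwise distinct, so codewords are at distance at least \<open>3\<close>. Each of the remaining residues
  \<open>\<plusminus>1, \<plusminus>5, 6\<close> is a sum of two such steps, so the covering radius is at most \<open>2\<close>, and a vertex of
  syndrome \<open>1\<close> shows that it is not smaller.\<close>

section \<open>Distances in terms of powers of the arc relation\<close>

lemma awalk_imp_relpow:
  assumes "pair_wf_digraph G" "pre_digraph.awalk (with_proj G) u p v"
  shows "(u, v) \<in> parcs G ^^ length p"
proof -
  interpret pair_wf_digraph G by fact
  show ?thesis
    using assms(2)
  proof (induction p arbitrary: u)
    case Nil
    then show ?case by (simp add: awalk_Nil_iff)
  next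
    case (Cons e p)
    then have "e \<in> parcs G" "fst e = u" "awalk (snd e) p v"
      by (auto simp: awalk_Cons_iff)
    with Cons.IH show ?case
      by (metis length_Cons prod.collapse relpow_Suc_I2)
  qed
qed

lemma relpow_imp_awalk:
  assumes "pair_wf_digraph G" "u \<in> pverts G" "(u, v) \<in> parcs G ^^ n"
  shows "\<exists>p. pre_digraph.awalk (with_proj G) u p v \<and> length p = n"
proof -
  interpret pair_wf_digraph G by fact
  show ?thesis
    using assms(2,3)
  proof (induction n arbitrary: u)
    case 0
    then show ?case by (auto simp: awalk_Nil_iff)
  next
    case (Suc n)
    then obtain w where w: "(u, w) \<in> parcs G" "(w, v) \<in> parcs G ^^ n"
      by (blast dest: relpow_Suc_D2)
    then obtain p where "awalk w p v" "length p = n"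
      using Suc.IH in_arcsD2 by blast
    with w(1) show ?case
      by (intro exI[of _ "(u, w) # p"]) (auto simp: awalk_Cons_iff)
  qed
qed

lemma (in wf_digraph) awalk_cost_one: "awalk_cost (\<lambda>_. 1) p = real (length p)"
  by (induction p) auto

text \<open>The distance is an infimum of walk costs, so a strict bound already yields a walk below
  it; with strict \<open><\<close>, attainment of the infimum is not an issue.\<close>

lemma graph_dist_less_iff:
  assumes "pair_wf_digraph G" "u \<in> pverts G"
  shows "graph_dist G u v < ereal (real n) \<longleftrightarrow> (\<exists>m<n. (u, v) \<in> parcs G ^^ m)"
proof -
  interpret pair_wf_digraph G by fact
  have "graph_dist G u v < ereal (real n) \<longleftrightarrow> (\<exists>p. awalk u p v \<and> length p < n)"
    by (auto simp: graph_dist_def \<mu>_def INF_less_iff awalk_cost_one)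
  also have "\<dots> \<longleftrightarrow> (\<exists>m<n. (u, v) \<in> parcs G ^^ m)"
    using awalk_imp_relpow[OF assms(1)] relpow_imp_awalk[OF assms] by blast
  finally show ?thesis .
qed

lemma graph_dist_le:
  assumes "pair_wf_digraph G" "u \<in> pverts G" "(u, v) \<in> parcs G ^^ m"
  shows "graph_dist G u v \<le> ereal (real m)"
proof -
  interpret pair_wf_digraph G by fact
  obtain p where p: "awalk u p v" "length p = m"
    using relpow_imp_awalk[OF assms] by blast
  then have "awalk_cost (\<lambda>_. 1) p = real m"
    by (simp add: awalk_cost_one)
  with min_cost_le_walk_cost[OF p(1), of "\<lambda>_. 1"] show ?thesis
    by (simp add: graph_dist_def)
qed

text \<open>Distance below 3 means a walk of length 0, 1 or 2: equality, adjacency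
  (\<open>indep\<close>) or a common neighbour (\<open>common\<close>). The vertex \<open>x\<close>
  has no walk of length below 2 to the code, which bounds the covering radius from below.\<close>

lemma quasi_perfect_1I:
  assumes G: "pair_wf_digraph G" and D: "D \<subseteq> pverts G"
    and indep: "\<And>u v. u \<in> D \<Longrightarrow> v \<in> D \<Longrightarrow> (u, v) \<notin> parcs G"
    and common: "\<And>u v w. u \<in> D \<Longrightarrow> v \<in> D \<Longrightarrow> (u, w) \<in> parcs G \<Longrightarrow> (w, v) \<in> parcs G \<Longrightarrow> u = v"
    and cover: "\<And>v. v \<in> pverts G \<Longrightarrow> \<exists>m\<le>2. \<exists>c\<in>D. (v, c) \<in> parcs G ^^ m"
    and deep: "x \<in> pverts G" "x \<notin> D" "\<And>c. c \<in> D \<Longrightarrow> (x, c) \<notin> parcs G"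
  shows "quasi_perfect G 1 D"
proof -
  have "ereal (real (2 * 1 + 1)) \<le> graph_dist G u v"
    if uv: "u \<in> D" "v \<in> D" "u \<noteq> v" for u v
  proof (rule ccontr)
    assume "\<not> ?thesis"
    then have "graph_dist G u v < ereal (real 3)"
      by (simp add: not_le)
    then obtain m where m: "m < 3" "(u, v) \<in> parcs G ^^ m"
      using graph_dist_less_iff[OF G] uv D by blast
    then have "m = 0 \<or> m = 1 \<or> m = 2" by linarith
    with m uv indep common show False
      by (auto simp: numeral_2_eq_2)
  qed
  then have "error_correcting G 1 D"
    using D by (simp add: error_correcting_def)
  moreover have "covering_radius G D = enat 2"
    unfolding covering_radius_def
  proof (rule antisym)
    have "\<exists>c\<in>D. graph_dist G v c \<le> ereal (real 2)" if v: "v \<in> pverts G" for v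
    proof -
      obtain m c where mc: "m \<le> 2" "c \<in> D" "(v, c) \<in> parcs G ^^ m"
        using cover[OF v] by blast
      have "graph_dist G v c \<le> ereal (real 2)"
        using graph_dist_le[OF G v mc(3)] mc(1) by (simp add: order.trans)
      with mc(2) show ?thesis by blast
    qed
    then show "Inf {enat r |r. \<forall>v\<in>pverts G. \<exists>c\<in>D. graph_dist G v c \<le> ereal (real r)} \<le> enat 2"
      by (intro Inf_lower) blast
    show "enat 2 \<le> Inf {enat r |r. \<forall>v\<in>pverts G. \<exists>c\<in>D. graph_dist G v c \<le> ereal (real r)}"
    proof (rule Inf_greatest, clarify)
      fix r assume "\<forall>v\<in>pverts G. \<exists>c\<in>D. graph_dist G v c \<le> ereal (real r)"
      then obtain c where c: "c \<in> D" "graph_dist G x c \<le> ereal (real r)"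
        using deep(1) by blast
      have "\<not> graph_dist G x c < ereal (real 2)"
        unfolding graph_dist_less_iff[OF G deep(1)]
        using c(1) deep(2,3) by (auto dest!: less_2_cases)
      with c(2) have "real 2 \<le> real r"
        by (metis ereal_less_eq(3) not_le order.trans)
      then show "enat 2 \<le> enat r" by simp
    qed
  qed
  ultimately show ?thesis
    by (simp add: quasi_perfect_def numeral_2_eq_2)
qed

section \<open>The syndrome and its change along arcs\<close>

definition syndrome :: "nat \<times> nat \<times> nat \<Rightarrow> nat" where
  "syndrome = (\<lambda>(x, y, z). (4 * x + 2 * y + 3 * z) mod 12)"

abbreviation product_graph :: "nat \<Rightarrow> nat \<Rightarrow> nat \<Rightarrow> (nat \<times> nat \<times> nat) pair_pre_digraph" where
  "product_graph p q k \<equiv> cycle_graph (3 * p) \<box> cycle_graph (6 * q) \<box> cycle_graph (4 * k)"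

text \<open>The neighbour whose syndrome exceeds that of the given vertex by \<open>d\<close>, modulo \<open>12\<close>;
  \<open>d\<close> ranges over \<open>steps\<close>.\<close>

definition move ::
    "nat \<Rightarrow> nat \<Rightarrow> nat \<Rightarrow> nat \<Rightarrow> nat \<times> nat \<times> nat \<Rightarrow> nat \<times> nat \<times> nat" where
  "move p q k d = (\<lambda>(x, y, z).
     if d = 4 then ((x + 1) mod (3 * p), y, z)
     else if d = 8 then ((x + (3 * p - 1)) mod (3 * p), y, z)
     else if d = 2 then (x, (y + 1) mod (6 * q), z)
     else if d = 10 then (x, (y + (6 * q - 1)) mod (6 * q), z)
     else if d = 3 then (x, y, (z + 1) mod (4 * k))
     else (x, y, (z + (4 * k - 1)) mod (4 * k)))"

text \<open>In natural numbers, 8, 9 and 10 stand for -4, -3 and -2 modulo 12.\<close>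

definition steps :: "nat set" where
  "steps = {2, 3, 4, 8, 9, 10}"

text \<open>The predecessor is reached by adding \<open>n - 1\<close>, which avoids truncation at
  \<open>i = 0\<close> and gives both neighbours the form \<open>(i + t) mod n\<close>.\<close>

lemma cycle_graph_arc_iff:
  assumes "i < n"
  shows "(i, j) \<in> parcs (cycle_graph n) \<longleftrightarrow> j = (i + 1) mod n \<or> j = (i + (n - 1)) mod n"
proof -
  have "(j < n \<and> i = Suc j mod n) \<longleftrightarrow> j = (i + (n - 1)) mod n"
  proof (cases i)
    case 0
    with assms show ?thesis by (auto simp: mod_Suc)
  next
    case (Suc m)
    then have "(i + (n - 1)) mod n = m"
      using assms by (simp add: mod_if)
    with assms Suc show ?thesis by (auto simp: mod_Suc)
  qed
  then show ?thesis
    using assms by (auto simp: cycle_graph_def)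
qed

lemma product_graph_arc_iff:
  assumes "u \<in> pverts (product_graph p q k)"
  shows "(u, v) \<in> parcs (product_graph p q k) \<longleftrightarrow> (\<exists>d\<in>steps. v = move p q k d u)"
proof -
  obtain x y z where u: "u = (x, y, z)" by (cases u) auto
  have "x < 3 * p" "y < 6 * q" "z < 4 * k"
    using assms u by (auto simp: cartesian_product_def cycle_graph_def)
  note arc = this[THEN cycle_graph_arc_iff]
  have verts: "x \<in> pverts (cycle_graph (3 * p))" "y \<in> pverts (cycle_graph (6 * q))"
    "z \<in> pverts (cycle_graph (4 * k))"
    using assms u by (auto simp: cartesian_product_def)
  obtain x' y' z' where v: "v = (x', y', z')" by (cases v) auto
  show ?thesis
    unfolding u v cartesian_product_def steps_def move_def
    using verts by (simp add: arc) blast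
qed

text \<open>Reduction modulo \<open>n\<close> changes \<open>x + t\<close> by a multiple of
  \<open>n\<close>, hence the product with \<open>a\<close> by a multiple of \<open>a * n\<close>,
  which vanishes modulo \<open>m\<close>.\<close>

lemma mult_mod_add_mod_cancel:
  fixes a c m n t x :: nat
  assumes "m dvd a * n"
  shows "(a * ((x + t) mod n) + c) mod m = (a * x + a * t + c) mod m"
proof -
  have "a * ((x + t) mod n) mod m = a * (x + t) mod m"
    using assms by (simp only: mult_mod_right mod_mod_cancel)
  then show ?thesis
    by (metis mod_add_left_eq distrib_left)
qed

lemma syndrome_move:
  assumes "p > 0" "q > 0" "k > 0" "d \<in> steps"
  shows "syndrome (move p q k d u) = (syndrome u + d) mod 12"
proof -
  obtain x y z where u: "u = (x, y, z)" by (cases u) auto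
  define s where "s = 4 * x + 2 * y + 3 * z"
  have X: "(4 * ((x + t) mod (3 * p)) + 2 * y + 3 * z) mod 12 = (s + 4 * t) mod 12" for t
    using mult_mod_add_mod_cancel[of 12 4 "3 * p" x t "2 * y + 3 * z"]
    by (simp add: s_def ac_simps)
  have Y: "(4 * x + 2 * ((y + t) mod (6 * q)) + 3 * z) mod 12 = (s + 2 * t) mod 12" for t
    using mult_mod_add_mod_cancel[of 12 2 "6 * q" y t "4 * x + 3 * z"]
    by (simp add: s_def ac_simps)
  have Z: "(4 * x + 2 * y + 3 * ((z + t) mod (4 * k))) mod 12 = (s + 3 * t) mod 12" for t
    using mult_mod_add_mod_cancel[of 12 3 "4 * k" z t "4 * x + 2 * y"]
    by (simp add: s_def ac_simps)
  \<comment> \<open>Successors remove the truncated subtraction: a backward step adds 8, 10 or 9 up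
    to a multiple of 12.\<close>
  obtain p' q' k' where "p = Suc p'" "q = Suc q'" "k = Suc k'"
    using assms by (metis gr0_implies_Suc)
  then have "s + 4 * (3 * p - 1) = (s + 8) + 12 * p'" "s + 2 * (6 * q - 1) = (s + 10) + 12 * q'"
    "s + 3 * (4 * k - 1) = (s + 9) + 12 * k'"
    by simp_all
  then have wrap: "(s + 4 * (3 * p - 1)) mod 12 = (s + 8) mod 12"
    "(s + 2 * (6 * q - 1)) mod 12 = (s + 10) mod 12"
    "(s + 3 * (4 * k - 1)) mod 12 = (s + 9) mod 12"
    by (simp_all only: mod_mult_self2)
  have "syndrome u = s mod 12"
    by (simp add: u syndrome_def s_def)
  moreover have "syndrome (move p q k d u) = (s + d) mod 12"
  proof -
    consider "d = 2" | "d = 3" | "d = 4" | "d = 8" | "d = 9" | "d = 10"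
      using assms(4) by (auto simp: steps_def)
    then show ?thesis
      \<comment> \<open>The deletions keep \<open>x + 1\<close> from becoming \<open>Suc x\<close>,
        so that \<open>X\<close>, \<open>Y\<close> and \<open>Z\<close> match with
        \<open>t = 1\<close>.\<close>
      by cases (simp_all add: u syndrome_def move_def X Y Z wrap del: One_nat_def add_Suc_right)
  qed
  ultimately show ?thesis
    by (simp add: mod_add_left_eq)
qed

section \<open>Quasi-perfectness of the zero-syndrome code\<close>

lemma quasi_perfect_syndrome_code:
  assumes pos: "p > 0" "q > 0" "k > 0"
  defines "G \<equiv> product_graph p q k"
  shows "quasi_perfect G 1 {u \<in> pverts G. syndrome u = 0}"
proof -
  have "pair_graph G"
    using pos unfolding G_def by (intro pair_graph_cartesian_product pair_graph_cycle_graph) auto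
  then interpret pair_graph G .
  note arc_iff = product_graph_arc_iff[of _ p q k, folded G_def]
  note synd = syndrome_move[OF pos]
  have arcI: "(u, move p q k d u) \<in> parcs G" if "u \<in> pverts G" "d \<in> steps" for u d
    using that arc_iff by blast
  have arc_synd: "\<exists>d\<in>steps. v = move p q k d u \<and> syndrome v = (syndrome u + d) mod 12"
    if "(u, v) \<in> parcs G" for u v
    using that arc_iff[of u v] in_arcsD1 synd by blast
  show ?thesis
  proof (rule quasi_perfect_1I)
    show "pair_wf_digraph G" by unfold_locales
    fix u v
    assume "u \<in> {u \<in> pverts G. syndrome u = 0}" "v \<in> {u \<in> pverts G. syndrome u = 0}"
    then have uv: "syndrome u = 0" "syndrome v = 0" by auto
    show "(u, v) \<notin> parcs G"
      using arc_synd[of u v] uv by (auto simp: steps_def)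
    fix w
    assume "(u, w) \<in> parcs G" "(w, v) \<in> parcs G"
    \<comment> \<open>Reversing the first arc makes \<open>u\<close> and \<open>v\<close> two moves
      from the same vertex \<open>w\<close>; both step sizes are the negative of its syndrome modulo
      12, hence equal.\<close>
    then have "(w, u) \<in> parcs G" "(w, v) \<in> parcs G"
      using arcs_symmetric by blast+
    then obtain d e where d: "d \<in> steps" "u = move p q k d w" "(syndrome w + d) mod 12 = 0"
      and e: "e \<in> steps" "v = move p q k e w" "(syndrome w + e) mod 12 = 0"
      using arc_synd uv by metis
    have "d < 12" "e < 12"
      using d(1) e(1) by (auto simp: steps_def)
    with d(3) e(3) have "d = e" by presburger
    with d e show "u = v" by simp
  next
    fix u assume u: "u \<in> pverts G"
    have "syndrome u < 12"
      by (auto simp: syndrome_def split: prod.splits)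
    then have "syndrome u \<in> {0, 1, 2, 3, 4, 5, 6, 7, 8, 9, 10, 11}"
      unfolding insert_iff empty_iff by presburger
    \<comment> \<open>One step clears 2, 3, 4, 8, 9, 10. For 1, 5, 6, 7, 11 one may take the pairs
      2+9, 3+4, 2+4, 2+3, 3+10.\<close>
    then consider "syndrome u = 0" | "\<exists>d\<in>steps. (syndrome u + d) mod 12 = 0"
      | "\<exists>d\<in>steps. \<exists>e\<in>steps. (syndrome u + d + e) mod 12 = 0"
      unfolding steps_def by (simp, elim disjE) simp_all
    then show "\<exists>m\<le>2. \<exists>c\<in>{u \<in> pverts G. syndrome u = 0}. (u, c) \<in> parcs G ^^ m"
    proof cases
      case 1
      with u show ?thesis by (intro exI[of _ 0]) auto
    next
      case 2
      then obtain d where d: "d \<in> steps" "(syndrome u + d) mod 12 = 0"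
        by (rule bexE)
      have "(u, move p q k d u) \<in> parcs G ^^ 1"
        using arcI[OF u d(1)] by simp
      moreover have "move p q k d u \<in> pverts G" "syndrome (move p q k d u) = 0"
        using in_arcsD2[OF arcI[OF u d(1)]] synd[OF d(1)] d(2) by simp_all
      ultimately show ?thesis
        by (intro exI[of _ 1] conjI bexI[of _ "move p q k d u"]) simp_all
    next
      case 3
      then obtain d e where de: "d \<in> steps" "e \<in> steps" "(syndrome u + d + e) mod 12 = 0"
        by (elim bexE)
      define v where "v = move p q k d u"
      have uv: "(u, v) \<in> parcs G" unfolding v_def by (rule arcI[OF u de(1)])
      then have vw: "(v, move p q k e v) \<in> parcs G"
        using arcI in_arcsD2 de(2) by blast
      have "syndrome (move p q k e v) = 0"
        using de synd by (simp add: v_def mod_add_left_eq)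
      moreover have "(u, move p q k e v) \<in> parcs G ^^ 2"
        using uv vw by (auto simp: numeral_2_eq_2)
      ultimately show ?thesis
        using in_arcsD2[OF vw] by blast
    qed
  next
    \<comment> \<open>This vertex lies in every such product and has syndrome 13 mod 12 = 1;
      clearing it in one step would need 11, which is not in \<open>steps\<close>.\<close>
    show "(1, 0, 3) \<in> pverts G"
      using pos by (auto simp: G_def cartesian_product_def cycle_graph_def)
    show "(1, 0, 3) \<notin> {u \<in> pverts G. syndrome u = 0}"
      by (simp add: syndrome_def)
    show "((1, 0, 3), c) \<notin> parcs G" if "c \<in> {u \<in> pverts G. syndrome u = 0}" for c
      using that arc_synd[of "(1, 0, 3)" c] by (auto simp: steps_def syndrome_def)
  qed auto
qed

theorem theorem5:
  shows "(\<forall>k::nat. k > 0 \<longrightarrow>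
            (\<exists>D. quasi_perfect (cycle_graph 3 \<box> cycle_graph 6 \<box> cycle_graph (4 * k)) 1 D)) \<and>
         (\<forall>p q k::nat. p > 0 \<longrightarrow> q > 0 \<longrightarrow> k > 0 \<longrightarrow>
            (\<exists>D. quasi_perfect (cycle_graph (3 * p) \<box> cycle_graph (6 * q) \<box> cycle_graph (4 * k)) 1 D))"
proof (intro conjI allI impI)
  fix k :: nat assume "k > 0"
  \<comment> \<open>This is the case p = q = 1 of the general family.\<close>
  then show "\<exists>D. quasi_perfect (cycle_graph 3 \<box> cycle_graph 6 \<box> cycle_graph (4 * k)) 1 D"
    using quasi_perfect_syndrome_code[of 1 1 k] unfolding mult_1_right using zero_less_one by blast
qed (blast intro: quasi_perfect_syndrome_code)

end
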